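(* (i) For every Christoffel $ab$-word $w$, the $t$-deformation $f_w(t)$ and the $q$-deformation $h_w(q)$ of the Markov number corresponding to $w$ satisfy $$f_w\!\left(\frac{[3]_q}{q}\right)=q\,h_w(q).$$ (ii) The set of $q$-deformations $\{h_w(q)\}_w$ and the set of $t$-deformations $\{f_w(t)\}_w$, where $w$ runs over the Christoffel $ab$-words, are in one-to-one correspondence via $f_w\leftrightarrow h_w$.
   Context: $q$ and $t$ are formal parameters and $[3]_q=1+q+q^2$. Triples of Christoffel $ab$-words are the triples of words in the letters $a,b$ generated as follows: $(a,ab,b)$ is such a triple, and whenever $(w,ww',w')$ is such a triple (where $ww'$ is concatenation), so are $(w,\,www',\,ww')$ and $(ww',\,ww'w',\,w')$; all triples arise this way. A Christoffel $ab$-word is a word occurring in some such triple. $q$-deformations: put $$A_q=\begin{pmatrix} q+1 & q^{-1}\\ 1 & q^{-1}\end{pmatrix},\qquad B_q=\begin{pmatrix} \frac{q^3+q^2+2q+1}{q} & \frac{q+1}{q^2}\\ \frac{q+1}{q} & q^{-2}\end{pmatrix},$$ let $w(A_q,B_q)$ be the matrix product obtained by substituting $A_q$ for $a$ and $B_q$ for $b$ in $w$, and set $h_w(q)=\mathrm{Tr}(w(A_q,B_q))/[3]_q$ (an element of $\mathbb{Z}[q,q^{-1}]$). $t$-deformations: the polynomials $f_w(t)\in\mathbb{Z}[t]$ are defined recursively along the tree of triples by $f_a(t)=1$, $f_{ab}(t)=t^2-t-1$, $f_b(t)=t-1$ and, for each triple $(w,ww',w')$, $$f_{www'}(t)=t\,f_w(t)f_{ww'}(t)-f_{w'}(t),\qquad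 f_{ww'w'}(t)=t\,f_{ww'}(t)f_{w'}(t)-f_w(t).$$ *)

theory Defs
  imports
    "HOL-Analysis.Analysis"
    "HOL-Computational_Algebra.Computational_Algebra"
begin

datatype letter = La | Lb

type_synonym word = "letter list"

inductive christoffel_triple :: "word \<Rightarrow> word \<Rightarrow> word \<Rightarrow> bool" where
  root: "christoffel_triple [La] [La, Lb] [Lb]"
| left: "christoffel_triple w (w @ w') w' \<Longrightarrow> christoffel_triple w (w @ w @ w') (w @ w')"
| right: "christoffel_triple w (w @ w') w' \<Longrightarrow> christoffel_triple (w @ w') (w @ w' @ w') w'"

definition christoffel_word :: "word \<Rightarrow> bool" where
  "christoffel_word w \<longleftrightarrow>
     (\<exists>u x v. christoffel_triple u x v \<and> (w = u \<or> w = x \<or> w = v))"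

(* The q-deformations live in the field of rational functions in q, which contains
   the ring of Laurent polynomials with integer coefficients. *)

definition qvar :: "int poly fract" where
  "qvar = to_fract [:0, 1:]"

definition q_three :: "int poly fract" where
  "q_three = 1 + qvar + qvar ^ 2"

definition A_q :: "int poly fract ^ 2 ^ 2" where
  "A_q = vector [vector [qvar + 1, inverse qvar],
                 vector [1,        inverse qvar]]"

definition B_q :: "int poly fract ^ 2 ^ 2" where
  "B_q = vector [vector [(qvar ^ 3 + qvar ^ 2 + 2 * qvar + 1) / qvar, (qvar + 1) / qvar ^ 2],
                 vector [(qvar + 1) / qvar,                           inverse (qvar ^ 2)]]"

primrec letter_subst :: "'a::semiring_1 ^ 'n ^ 'n \<Rightarrow> 'a ^ 'n ^ 'n \<Rightarrow> letter \<Rightarrow> 'a ^ 'n ^ 'n" where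
  "letter_subst A B La = A"
| "letter_subst A B Lb = B"

primrec word_subst :: "'a::semiring_1 ^ 'n ^ 'n \<Rightarrow> 'a ^ 'n ^ 'n \<Rightarrow> word \<Rightarrow> 'a ^ 'n ^ 'n" where
  "word_subst A B [] = mat 1"
| "word_subst A B (l # w) = letter_subst A B l ** word_subst A B w"

definition q_deform :: "word \<Rightarrow> int poly fract" where
  "q_deform w = trace (word_subst A_q B_q w) / q_three"

abbreviation tvar :: "int poly" where
  "tvar \<equiv> [:0, 1:]"

(* The tree of triples, with each word paired with the polynomial in t that the
   recursion attaches to it. *)
inductive t_triple :: "word \<times> int poly \<Rightarrow> word \<times> int poly \<Rightarrow> word \<times> int poly \<Rightarrow> bool" where
  root: "t_triple ([La], 1) ([La, Lb], tvar ^ 2 - tvar - 1) ([Lb], tvar - 1)"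
| left: "t_triple (w, f) (w @ w', g) (w', f') \<Longrightarrow>
         t_triple (w, f) (w @ w @ w', tvar * f * g - f') (w @ w', g)"
| right: "t_triple (w, f) (w @ w', g) (w', f') \<Longrightarrow>
          t_triple (w @ w', g) (w @ w' @ w', tvar * g * f' - f) (w', f')"

(* For a Christoffel word w, the same polynomial is attached to w at all of its
   occurrences in the tree, so the description below is definite.  On other words
   the value is unspecified. *)
definition t_deform :: "word \<Rightarrow> int poly" where
  "t_deform w = (THE p. \<exists>x y z. t_triple x y z \<and> (w, p) \<in> {x, y, z})"

(* Value of an integer polynomial at an element of another ring. *)
definition int_poly_eval :: "int poly \<Rightarrow> 'a::comm_ring_1 \<Rightarrow> 'a" where
  "int_poly_eval p x = poly (map_poly of_int p) x"

end

theory Submission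
  imports Defs
begin

text \<open>
  Since \<open>A_q\<close> and \<open>B_q\<close> have determinant 1, the Cayley--Hamilton theorem for 2 by 2 matrices
  turns the traces of their products into solutions of the recursion defining the
  \<open>t\<close>-deformations, with \<open>t\<close> specialised to \<open>[3]\<^sub>q / q\<close>. This element is transcendental over
  the integers, so the specialisation is injective on integer polynomials; hence a polynomial
  attached to a word anywhere in the tree is determined by the \<open>q\<close>-deformation of that word, which
  gives both the well-definedness of the \<open>t\<close>-deformation and the bijection.
\<close>

text \<open>Cayley-Hamilton gives \<open>M ** M\<close> as \<open>trace M\<close> times
  \<open>M\<close> minus \<open>det M\<close> times the identity; multiply by \<open>N\<close> on
  the right and take traces.\<close>

lemma trace_square_mult_2:
  fixes M N :: "'a::comm_ring_1 ^ 2 ^ 2"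
  shows "trace (M ** (M ** N)) = trace M * trace (M ** N) - det M * trace N"
  by (simp add: trace_def det_2 matrix_matrix_mult_def sum_2 algebra_simps)

lemma trace_mult_square_2:
  fixes M N :: "'a::comm_ring_1 ^ 2 ^ 2"
  shows "trace (M ** (N ** N)) = trace (M ** N) * trace N - det N * trace M"
  by (simp add: trace_def det_2 matrix_matrix_mult_def sum_2 algebra_simps)

lemma word_subst_append: "word_subst A B (u @ v) = word_subst A B u ** word_subst A B v"
  by (induction u) (simp_all add: matrix_mul_assoc)

lemma det_word_subst:
  fixes A B :: "'a::comm_ring_1 ^ 'n ^ 'n"
  assumes "det A = 1" "det B = 1"
  shows "det (word_subst A B w) = 1"
proof (induction w)
  case (Cons l w)
  then show ?case using assms by (cases l) (simp_all add: det_mul)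
qed simp

lemma int_poly_eval_0 [simp]: "int_poly_eval 0 x = 0"
  by (simp add: int_poly_eval_def)

lemma int_poly_eval_pCons [simp]:
  "int_poly_eval (pCons a p) x = of_int a + x * int_poly_eval p x"
  by (simp add: int_poly_eval_def map_poly_pCons)

lemma int_poly_eval_1 [simp]: "int_poly_eval 1 x = 1"
  by (simp add: one_pCons)

lemma int_poly_eval_add: "int_poly_eval (p + q) x = int_poly_eval p x + int_poly_eval q x"
  by (induction p q rule: poly_induct2) (simp_all add: algebra_simps)

lemma int_poly_eval_diff: "int_poly_eval (p - q) x = int_poly_eval p x - int_poly_eval q x"
  using int_poly_eval_add[of "p - q" q x] by simp

lemma int_poly_eval_smult: "int_poly_eval (smult c p) x = of_int c * int_poly_eval p x"
  by (induction p) (simp_all add: algebra_simps)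

lemma int_poly_eval_mult: "int_poly_eval (p * q) x = int_poly_eval p x * int_poly_eval q x"
  by (induction p) (simp_all add: int_poly_eval_add int_poly_eval_smult algebra_simps)

lemma int_poly_eval_altdef:
  "int_poly_eval p x = (\<Sum>i\<le>degree p. of_int (coeff p i) * x ^ i)"
proof -
  have "degree (map_poly of_int p :: 'a poly) \<le> degree p"
    by (rule map_poly_degree_leq)
  \<comment> \<open>In positive characteristic \<open>of_int\<close> may kill the leading
    coefficient, so the mapped polynomial can have smaller degree; the extra terms vanish.\<close>
  then have "int_poly_eval p x = (\<Sum>i\<le>degree p. coeff (map_poly of_int p) i * x ^ i)"
    unfolding int_poly_eval_def poly_altdef
    by (intro sum.mono_neutral_left) (auto simp: coeff_eq_0)
  then show ?thesis by (simp add: coeff_map_poly)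
qed

lemma to_fract_power: "to_fract (x ^ n) = to_fract x ^ n"
  by (induction n) simp_all

lemma to_fract_sum: "to_fract (sum f A) = (\<Sum>x\<in>A. to_fract (f x))"
  by (induction A rule: infinite_finite_induct) simp_all

lemma to_fract_of_int: "to_fract (of_int n) = of_int n"
proof -
  have "to_fract (of_nat m) = (of_nat m :: 'a fract)" for m
    by (induction m) simp_all
  then show ?thesis by (cases n rule: int_cases2) simp_all
qed

text \<open>Clearing denominators moves the value from the fraction field into the base ring. For
  polynomials \<open>r\<close> and \<open>s\<close> in q, the result can then itself be evaluated at
  a point.\<close>

lemma int_poly_eval_homogenize:
  fixes r s :: "'a::idom"
  assumes "s \<noteq> 0"
  shows "int_poly_eval p (to_fract r / to_fract s) * to_fract s ^ degree p =
    to_fract (\<Sum>i\<le>degree p. of_int (coeff p i) * r ^ i * s ^ (degree p - i))"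
  unfolding int_poly_eval_altdef sum_distrib_right to_fract_sum
proof (intro sum.cong refl)
  fix i assume "i \<in> {..degree p}"
  then have "to_fract s ^ degree p = to_fract s ^ i * to_fract s ^ (degree p - i)"
    by (simp flip: power_add)
  then show "of_int (coeff p i) * (to_fract r / to_fract s) ^ i * to_fract s ^ degree p =
      to_fract (of_int (coeff p i) * r ^ i * s ^ (degree p - i))"
    using assms by (simp add: to_fract_power to_fract_of_int power_divide)
qed

lemma qvar_nonzero [simp]: "qvar \<noteq> 0"
  by (simp add: qvar_def)

lemma q_three_eq: "q_three = to_fract [:1, 1, 1:]"
proof -
  have "q_three = to_fract (1 + [:0, 1:] + [:0, 1:] ^ 2)"
    by (simp only: q_three_def qvar_def to_fract_add to_fract_power to_fract_1)
  then show ?thesis by (simp add: one_pCons power2_eq_square)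
qed

lemma q_three_nonzero [simp]: "q_three \<noteq> 0"
  by (simp add: q_three_eq)

text \<open>
  After clearing denominators, only the leading term of \<open>p\<close> survives at \<open>q = 0\<close>.
\<close>

lemma int_poly_eval_q_three_nonzero:
  assumes "p \<noteq> 0"
  shows "int_poly_eval p (q_three / qvar) \<noteq> 0"
proof
  let ?P = "\<Sum>i\<le>degree p. of_int (coeff p i) * [:1, 1, 1:] ^ i * [:0, 1:] ^ (degree p - i) :: int poly"
  assume "int_poly_eval p (q_three / qvar) = 0"
  then have "to_fract ?P = 0"
    using int_poly_eval_homogenize[of tvar p "[:1, 1, 1:]"]
    by (simp add: q_three_eq qvar_def)
  then have "poly ?P 0 = 0" by (metis poly_0 to_fract_eq_0_iff)
  moreover have "poly ?P 0 = (\<Sum>i\<le>degree p. if i = degree p then coeff p i else 0)"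
    unfolding poly_sum by (intro sum.cong) (auto simp: poly_power power_0_left of_int_poly)
  ultimately show False using assms by simp
qed

lemma inj_int_poly_eval_q_three: "inj (\<lambda>p. int_poly_eval p (q_three / qvar))"
proof (rule injI)
  fix p p' :: "int poly"
  assume "int_poly_eval p (q_three / qvar) = int_poly_eval p' (q_three / qvar)"
  then have "int_poly_eval (p - p') (q_three / qvar) = 0" by (simp add: int_poly_eval_diff)
  then show "p = p'" using int_poly_eval_q_three_nonzero[of "p - p'"] by auto
qed

lemma det_A_q: "det A_q = 1"
  by (simp add: A_q_def det_2 field_simps)

lemma det_B_q: "det B_q = 1"
  by (simp add: B_q_def det_2 divide_simps) (simp add: algebra_simps power2_eq_square power3_eq_cube)

lemma trace_word_subst: "trace (word_subst A_q B_q w) = q_three * q_deform w"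
  by (simp add: q_deform_def)

text \<open>This is the trace identity with determinant 1, divided by \<open>q_three\<close>. In
  terms of \<open>qvar * q_deform\<close> the coefficient becomes \<open>q_three / qvar\<close>,
  which is why t is specialised to this element.\<close>

lemma q_deform_left:
  "q_deform (u @ u @ v) = q_three * q_deform u * q_deform (u @ v) - q_deform v"
proof -
  have "q_three * q_deform (u @ u @ v) =
      q_three * (q_three * q_deform u * q_deform (u @ v) - q_deform v)"
    using trace_square_mult_2[of "word_subst A_q B_q u" "word_subst A_q B_q v"]
    by (simp add: det_word_subst det_A_q det_B_q trace_word_subst algebra_simps
        flip: word_subst_append)
  then show ?thesis by simp
qed

lemma q_deform_right:
  "q_deform (u @ v @ v) = q_three * q_deform (u @ v) * q_deform v - q_deform u"
proof -
  have "q_three * q_deform (u @ v @ v) =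
      q_three * (q_three * q_deform (u @ v) * q_deform v - q_deform u)"
    using trace_mult_square_2[of "word_subst A_q B_q u" "word_subst A_q B_q v"]
    by (simp add: det_word_subst det_A_q det_B_q trace_word_subst algebra_simps
        flip: word_subst_append)
  then show ?thesis by simp
qed

text \<open>In this and the next two lemmas, the right-hand sides are the root polynomials 1, t - 1
  and t^2 - t - 1 at t = \<open>q_three / qvar\<close>.\<close>

lemma q_deform_La: "qvar * q_deform [La] = 1"
  by (simp add: q_deform_def A_q_def trace_def sum_2 q_three_def[symmetric] divide_simps)
    (simp add: q_three_def algebra_simps power2_eq_square)

lemma q_deform_Lb: "qvar * q_deform [Lb] = q_three / qvar - 1"
  by (simp add: q_deform_def B_q_def trace_def sum_2 divide_simps)
    (simp add: q_three_def algebra_simps power2_eq_square power3_eq_cube)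

lemma q_deform_La_Lb: "qvar * q_deform [La, Lb] = (q_three / qvar) ^ 2 - q_three / qvar - 1"
  unfolding q_deform_def word_subst.simps letter_subst.simps matrix_mul_rid
  by (simp add: A_q_def B_q_def trace_def matrix_matrix_mult_def sum_2 divide_simps)
    (simp add: q_three_def algebra_simps power2_eq_square power3_eq_cube)

text \<open>The induction invariant concerns the polynomial attached in the tree, not
  \<open>t_deform\<close>, whose well-definedness is deduced from it.\<close>

definition correct_value :: "word \<times> int poly \<Rightarrow> bool" where
  "correct_value x \<longleftrightarrow> int_poly_eval (snd x) (q_three / qvar) = qvar * q_deform (fst x)"

lemma t_triple_correct_value:
  "t_triple x y z \<Longrightarrow> correct_value x \<and> correct_value y \<and> correct_value z"
proof (induction rule: t_triple.induct)
  case root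
  then show ?case
    \<comment> \<open>Without the \<open>mult_pCons\<close> rules, products with \<open>tvar\<close>
      stay products, which \<open>int_poly_eval_mult\<close> splits.\<close>
    by (simp add: correct_value_def int_poly_eval_diff int_poly_eval_mult power2_eq_square
        q_deform_La q_deform_Lb q_deform_La_Lb del: mult_pCons_left mult_pCons_right)
next
  case (left w f w' g f')
  then show ?case
    by (simp add: correct_value_def int_poly_eval_diff int_poly_eval_mult q_deform_left
        field_simps del: mult_pCons_left mult_pCons_right)
next
  case (right w f w' g f')
  then show ?case
    by (simp add: correct_value_def int_poly_eval_diff int_poly_eval_mult q_deform_right
        field_simps del: mult_pCons_left mult_pCons_right)
qed

text \<open>Both trees branch in the same way, so each Christoffel word has at least one attached
  polynomial.\<close>

lemma christoffel_triple_imp_t_triple: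
  "christoffel_triple u x v \<Longrightarrow> \<exists>f g h. t_triple (u, f) (x, g) (v, h)"
  by (induction rule: christoffel_triple.induct) (blast intro: t_triple.intros)+

lemma int_poly_eval_t_deform:
  assumes "christoffel_word w"
  shows "int_poly_eval (t_deform w) (q_three / qvar) = qvar * q_deform w"
proof -
  let ?attached = "\<lambda>p. \<exists>x y z. t_triple x y z \<and> (w, p) \<in> {x, y, z}"
  have correct: "int_poly_eval p (q_three / qvar) = qvar * q_deform w" if "?attached p" for p
    using that t_triple_correct_value by (fastforce simp: correct_value_def)
  obtain u x v where "christoffel_triple u x v" and w: "w = u \<or> w = x \<or> w = v"
    using assms by (auto simp: christoffel_word_def)
  then obtain f g h where "t_triple (u, f) (x, g) (v, h)"
    using christoffel_triple_imp_t_triple by blast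
  with w have "\<exists>p. ?attached p" by blast
  \<comment> \<open>Any two attached polynomials have the same value at
    \<open>q_three / qvar\<close>, hence agree by injectivity.\<close>
  then have "\<exists>!p. ?attached p"
    using correct injD[OF inj_int_poly_eval_q_three] by (metis (no_types, lifting))
  then have "?attached (t_deform w)" unfolding t_deform_def by (rule theI')
  then show ?thesis by (rule correct)
qed

theorem theorem4p1:
  shows "(\<forall>w. christoffel_word w \<longrightarrow>
            int_poly_eval (t_deform w) (q_three / qvar) = qvar * q_deform w) \<and>
         (\<exists>\<phi>. bij_betw \<phi> {t_deform w |w. christoffel_word w} {q_deform w |w. christoffel_word w} \<and>
              (\<forall>w. christoffel_word w \<longrightarrow> \<phi> (t_deform w) = q_deform w))"
proof (intro conjI exI)
  \<comment> \<open>Solving the identity of the first part for \<open>q_deform\<close> gives this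
    map; it is injective on all integer polynomials, so only its image remains to be found.\<close>
  let ?\<phi> = "\<lambda>p. int_poly_eval p (q_three / qvar) / qvar"
  show "\<forall>w. christoffel_word w \<longrightarrow>
      int_poly_eval (t_deform w) (q_three / qvar) = qvar * q_deform w"
    by (simp add: int_poly_eval_t_deform)
  show \<phi>: "\<forall>w. christoffel_word w \<longrightarrow> ?\<phi> (t_deform w) = q_deform w"
    by (simp add: int_poly_eval_t_deform)
  have "inj ?\<phi>"
    using inj_int_poly_eval_q_three by (simp add: inj_def)
  moreover have "?\<phi> ` {t_deform w |w. christoffel_word w} = {q_deform w |w. christoffel_word w}"
    using \<phi> by (force simp: image_iff)
  ultimately show "bij_betw ?\<phi> {t_deform w |w. christoffel_word w} {q_deform w |w. christoffel_word w}"
    unfolding bij_betw_def by (blast intro: inj_on_subset)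
qed

end
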